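(* Let $q$ be an odd prime power, $a$ an integer with $a\neq 0$ in $\mathbb{F}_q$, $n$ an even natural number, $d=\gcd(q-1,n)$, $\delta=\gcd(q+1,n)$, and $2^r$ the highest power of $2$ dividing $q^2-1$. Then the size of the value set of the $n$th Dickson polynomial over $\mathbb{F}_q$ is $$|\mathfrak{R}_q(D_n(x,a))|=\left\lfloor\frac{q-1}{2d}\right\rfloor+\left\lfloor\frac{q+1}{2\delta}\right\rfloor+1+\begin{cases}1&\text{if }\chi_q(a)=-1\text{ and }2^{r-1}\,\|\,n,\\ 0&\text{otherwise.}\end{cases}$$
   Context: The Dickson polynomials are defined by $D_0(x,a)=2$, $D_1(x,a)=x$, and $D_n(x,a)=xD_{n-1}(x,a)-aD_{n-2}(x,a)$ for $n\ge 2$. For an integral polynomial $f$, $\mathfrak{R}_q(f)\subseteq\mathbb{F}_q$ is the set of values taken by $f$ on $\mathbb{F}_q$. The integer $a$ is also viewed as an element of $\mathbb{F}_q$ via its image. $\chi_q$ is the quadratic character on $\mathbb{F}_q$: $\chi_q(a)=a^{(q-1)/2}$, equal to $0$ if $a=0$, $1$ if $a$ is a nonzero square, $-1$ if $a$ is a non-square. The notation $2^{s}\,\|\,n$ means $2^{s}\mid n$ and $2^{s+1}\nmid n$. *)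

theory Defs
  imports Complex_Main "HOL-Library.Cardinality" "HOL-Computational_Algebra.Polynomial"
    "HOL-Number_Theory.Prime_Powers"
begin

fun dickson_poly :: "nat \<Rightarrow> int \<Rightarrow> int poly" where
  "dickson_poly 0 a = [:2:]"
| "dickson_poly (Suc 0) a = [:0, 1:]"
| "dickson_poly (Suc (Suc n)) a =
     [:0, 1:] * dickson_poly (Suc n) a - smult a (dickson_poly n a)"

text \<open>The field with q elements is a finite field type 'k with q = CARD('k);
  an integral polynomial takes values on it after its coefficients are mapped to 'k.\<close>

definition value_set :: "int poly \<Rightarrow> ('k :: {field, finite}) set" where
  "value_set f = range (\<lambda>x. poly (map_poly of_int f) x)"

definition quadratic_char :: "'k :: {field, finite} \<Rightarrow> 'k" where
  "quadratic_char a = a ^ ((CARD('k) - 1) div 2)"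

definition power_exactly_dvd :: "nat \<Rightarrow> nat \<Rightarrow> nat \<Rightarrow> bool" where
  "power_exactly_dvd p s n \<longleftrightarrow> p ^ s dvd n \<and> \<not> p ^ (s + 1) dvd n"

lemma finite_field_power_card_minus_1:
  fixes a :: "'k :: {field, finite}"
  assumes "a \<noteq> 0"
  shows "a ^ (CARD('k) - 1) = 1"
proof -
  let ?U = "UNIV - {0 :: 'k}"
  have "bij_betw ((*) a) ?U ?U"
    by (rule bij_betwI[where g = "\<lambda>x. x / a"]) (use assms in auto)
  then have "(\<Prod>x\<in>?U. a * x) = \<Prod>?U"
    by (rule prod.reindex_bij_betw)
  then have "a ^ card ?U * \<Prod>?U = \<Prod>?U"
    by (simp add: prod.distrib)
  moreover have "\<Prod>?U \<noteq> 0"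
    by auto
  ultimately show ?thesis
    by (simp add: card_Diff_singleton)
qed

text \<open>The usual description of the quadratic character by squares. The values 0, 1, -1 are
  elements of the field; they are distinct because the characteristic is odd.\<close>

lemma
  fixes a :: "'k :: {field, finite}"
  assumes odd: "odd CARD('k)"
  shows quadratic_char_eq:
      "quadratic_char a = (if a = 0 then 0 else if \<exists>b. a = b ^ 2 then 1 else - 1)"
    and quadratic_char_eq_minus_1_iff:
      "quadratic_char a = - 1 \<longleftrightarrow> \<not> (\<exists>b. a = b ^ 2)"
proof -
  define m where "m = (CARD('k) - 1) div 2"
  have card: "CARD('k) - 1 = 2 * m"
    using odd by (auto simp: m_def elim!: oddE)
  note card' = card [simplified]
  have "card {0 :: 'k, 1} \<le> CARD('k)"
    by (rule card_mono) auto
  then have m: "m > 0"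
    using card by simp
  have pow: "x ^ (2 * m) = 1" if "x \<noteq> 0" for x :: 'k
    using finite_field_power_card_minus_1 [OF that] by (simp only: card)
  define U where "U = UNIV - {0 :: 'k}"
  define S where "S = (\<lambda>b. b ^ 2) ` U"
  define R where "R = {x :: 'k. x ^ m = 1}"
  have U: "card U = 2 * m"
    by (simp add: U_def card_Diff_singleton card')
  have "R = {x. poly (monom 1 m - 1) x = 0}"
    by (auto simp: R_def poly_monom)
  moreover have nz: "monom (1 :: 'k) m - 1 \<noteq> 0"
  proof
    assume "monom (1 :: 'k) m - 1 = 0"
    then have "coeff (monom (1 :: 'k) m - 1) m = 0" by simp
    then show False using m by simp
  qed
  moreover have "degree (monom (1 :: 'k) m - 1) \<le> m"
    by (rule degree_diff_le) (auto simp: degree_monom_eq)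
  ultimately have R: "card R \<le> m"
    using card_poly_roots_bound[OF nz] by simp
  have sub: "S \<subseteq> R"
    by (auto simp: S_def R_def U_def pow simp flip: power_mult)
  then have S: "card S \<le> m"
    using R card_mono[of R S] by simp
  have "U = (\<Union>s\<in>S. {b \<in> U. b ^ 2 = s})"
    by (auto simp: S_def)
  then have "card U \<le> (\<Sum>s\<in>S. card {b \<in> U. b ^ 2 = s})"
    using card_UN_le[of S "\<lambda>s. {b \<in> U. b ^ 2 = s}"] by simp
  also have "\<dots> \<le> (\<Sum>s\<in>S. 2)"
  proof (rule sum_mono)
    fix s assume "s \<in> S"
    then obtain c where "s = c ^ 2" by (auto simp: S_def)
    then have "{b \<in> U. b ^ 2 = s} \<subseteq> {c, - c}"
      by (auto simp: power2_eq_iff)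
    then have "card {b \<in> U. b ^ 2 = s} \<le> card {c, - c}"
      by (intro card_mono) auto
    also have "\<dots> \<le> 2" by (simp add: card_insert_if)
    finally show "card {b \<in> U. b ^ 2 = s} \<le> 2" .
  qed
  finally have "m \<le> card S" using U by simp
  then have "S = R"
    using sub R by (intro card_seteq) auto
  have ne: "(1 :: 'k) \<noteq> - 1"
  proof
    assume eq: "(1 :: 'k) = - 1"
    have "x = - x" for x :: 'k
      using arg_cong[OF eq, of "(*) x"] by simp
    then have "inj_on (\<lambda>b. b ^ 2) U"
      by (intro inj_onI) (metis power2_eq_iff)
    then have "card S = card U"
      unfolding S_def by (rule card_image)
    then show False using S U m by simp
  qed
  have char: "quadratic_char a = a ^ m"
    by (simp add: quadratic_char_def m_def)
  have pm: "a ^ m = 1 \<or> a ^ m = - 1" if "a \<noteq> 0"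
  proof -
    have "(a ^ m) ^ 2 = 1"
      using pow [OF that] by (simp add: mult.commute flip: power_mult)
    then show ?thesis by (simp add: power2_eq_1_iff)
  qed
  have sq: "a ^ m = 1 \<longleftrightarrow> (\<exists>b. a = b ^ 2)" if "a \<noteq> 0"
  proof -
    have "a ^ m = 1 \<longleftrightarrow> a \<in> S" by (simp add: \<open>S = R\<close> R_def)
    also have "\<dots> \<longleftrightarrow> (\<exists>b. a = b ^ 2)"
      using that by (auto simp: S_def U_def)
    finally show ?thesis .
  qed
  show eq: "quadratic_char a = (if a = 0 then 0 else if \<exists>b. a = b ^ 2 then 1 else - 1)"
  proof (cases "a = 0")
    case True
    then show ?thesis unfolding char using m by simp
  next
    case False
    then show ?thesis using pm [OF False] sq [OF False] unfolding char by presburger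
  qed
  show "quadratic_char a = - 1 \<longleftrightarrow> \<not> (\<exists>b. a = b ^ 2)"
      proof (cases "a = 0")
    case True
    then have "a = 0 ^ 2" by simp
    then show ?thesis unfolding eq using True by auto
  next
    case False
    then show ?thesis unfolding eq using ne by presburger
  qed
qed

end

theory Submission
  imports "HOL-Number_Theory.Residues" "HOL-Algebra.Algebraic_Closure_Type" Defs
begin

text \<open>
  Over an algebraic closure of the field with \<open>q\<close> elements, the elements of that field are exactly
  the \<open>y + a / y\<close> with \<open>y ^ (q - 1) = 1\<close> or \<open>y ^ (q + 1) = a\<close>, and \<open>D\<^sub>n\<close> sends such an element to
  \<open>z + a ^ n / z\<close> with \<open>z = y ^ n\<close>. So the value set has as many elements as the involution
  \<open>z \<mapsto> a ^ n / z\<close> has orbits on \<open>A \<union> B\<close>, where \<open>A\<close> and \<open>B\<close> are the sets of \<open>n\<close>-th powers of the two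
  kinds of \<open>y\<close>; they have \<open>(q - 1) / d\<close> and \<open>(q + 1) / \<delta>\<close> elements. The fixed points are
  \<open>\<plusminus> a ^ (n div 2)\<close>, they contain \<open>A \<inter> B\<close>, and whether they lie in \<open>A\<close> or \<open>B\<close> depends only on
  \<open>\<chi>(a)\<close> and on the parities of \<open>n / d\<close>, \<open>(q - 1) / d\<close>, \<open>n / \<delta>\<close>, \<open>(q + 1) / \<delta>\<close>.
\<close>

section \<open>Roots in algebraically closed fields\<close>

text \<open>The polynomial splits into linear factors, and a repeated factor would give a common
  root with the derivative; so the multiset of roots is a set.\<close>

lemma card_roots_eq_degree:
  fixes p :: "'a :: alg_closed_field poly"
  assumes "p \<noteq> 0" and separable: "\<And>x. poly p x = 0 \<Longrightarrow> poly (pderiv p) x \<noteq> 0"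
  shows "card {x. poly p x = 0} = degree p"
proof -
  obtain A where size: "size A = degree p"
    and p: "p = smult (lead_coeff p) (\<Prod>x\<in>#A. [:-x, 1:])"
    using alg_closed_imp_factorization[OF \<open>p \<noteq> 0\<close>] by blast
  have roots: "{x. poly p x = 0} = set_mset A"
    by (subst p) (use \<open>p \<noteq> 0\<close> in \<open>auto simp: poly_prod_mset prod_mset_zero_iff\<close>)
  have "count A x = 1" if "x \<in># A" for x
  proof (rule ccontr)
    assume "count A x \<noteq> 1"
    with that have "count A x \<ge> 2"
      by (metis One_nat_def Suc_1 Suc_leI count_greater_zero_iff le_neq_implies_less)
    then obtain B where "A = {#x, x#} + B"
      by (metis count_le_replicate_mset_subset_eq mset_subset_eq_exists_conv
          numeral_2_eq_2 replicate_mset_0 replicate_mset_Suc)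
    then obtain g where g: "p = [:-x, 1:] * ([:-x, 1:] * g)"
      by (metis (no_types, lifting) p add_mset_add_single image_mset_add_mset
          mult_smult_right prod_mset.add_mset union_mset_add_mset_left add_0)
    have "poly p x = 0" "poly (pderiv p) x = 0"
      by (simp_all add: g pderiv_mult del: mult_pCons_left)
    then show False
      using separable by blast
  qed
  then have "size A = card (set_mset A)"
    by (simp add: size_multiset_overloaded_eq)
  then show ?thesis
    by (simp add: roots size)
qed

text \<open>The derivative \<open>n * z ^ (n - 1)\<close> of \<open>z ^ n - c\<close> vanishes at
  most at 0, which is not a root.\<close>

lemma card_nth_roots_alg_closed:
  fixes c :: "'a :: alg_closed_field"
  assumes "of_nat n \<noteq> (0 :: 'a)" "c \<noteq> 0"
  shows "card {z. z ^ n = c} = n"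
proof -
  define p where "p = monom 1 n - [:c:]"
  have n: "n > 0"
    using assms(1) by (cases n) auto
  have deg: "degree p = n"
    using n degree_add_eq_left[of "- [:c:]" "monom 1 n"]
    by (simp add: p_def degree_monom_eq del: minus_pCons)
  have root: "poly p z = 0 \<longleftrightarrow> z ^ n = c" for z
    by (auto simp: p_def poly_monom)
  have "card {z. poly p z = 0} = degree p"
  proof (rule card_roots_eq_degree)
    show "p \<noteq> 0"
      using deg n by auto
    show "poly (pderiv p) z \<noteq> 0" if "poly p z = 0" for z
    proof -
      have "z \<noteq> 0"
        using that n \<open>c \<noteq> 0\<close> by (auto simp: root)
      then show ?thesis
        using assms(1) by (simp add: p_def pderiv_diff pderiv_monom poly_monom pderiv_pCons)
    qed
  qed
  then show ?thesis
    by (simp add: root deg)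
qed

text \<open>Used with \<open>d\<close> the gcd of the two exponents. For the converse inclusion,
  start from any root \<open>w\<close> and correct it by a power of a root \<open>y\<close>, using
  that \<open>u\<close> is invertible modulo \<open>v\<close>.\<close>

lemma power_image_roots:
  fixes c :: "'a :: alg_closed_field"
  assumes "d > 0" "v > 0" "coprime u v" "c \<noteq> 0"
  shows "(\<lambda>y. y ^ (d * u)) ` {y. y ^ (d * v) = c} = {z. z ^ v = c ^ u}"
proof (intro equalityI subsetI)
  fix z assume "z \<in> (\<lambda>y. y ^ (d * u)) ` {y. y ^ (d * v) = c}"
  then obtain y where "z = y ^ (d * u)" "c = y ^ (d * v)"
    by auto
  then show "z \<in> {z. z ^ v = c ^ u}"
    by (simp add: mult_ac flip: power_mult)
next
  fix z assume "z \<in> {z. z ^ v = c ^ u}"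
  then have z: "z ^ v = c ^ u"
    by simp
  obtain w where w: "w ^ (d * v) = c"
    using nth_root_exists[of "d * v" c] assms by auto
  then have "w \<noteq> 0"
    using assms by auto
  \<comment> \<open>Both \<open>z\<close> and \<open>w ^ (d * u)\<close> have \<open>v\<close>-th
    power \<open>c ^ u\<close>, so \<open>y ^ d\<close> is a \<open>v\<close>-th root of
    unity.\<close>
  obtain y where y: "y ^ d = z / w ^ (d * u)"
    using nth_root_exists[of d "z / w ^ (d * u)"] assms by auto
  have "(w ^ (d * u)) ^ v = (w ^ (d * v)) ^ u"
    by (simp add: mult_ac flip: power_mult)
  then have yv: "(y ^ d) ^ v = 1"
    using \<open>c \<noteq> 0\<close> by (simp add: y w z power_divide)
  obtain k where "[u * k = 1] (mod v)"
    using cong_solve_coprime_nat[OF \<open>coprime u v\<close>] by auto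
  \<comment> \<open>The congruence as an equation of natural numbers, hence with multiples of
    \<open>v\<close> on both sides.\<close>
  then obtain i j where ij: "u * k + i * v = 1 + j * v"
    by (metis cong_iff_lin_nat mult.commute)
  have "(y ^ d) ^ (u * k) = (y ^ d) ^ (u * k + i * v)"
    by (simp add: power_add power_mult[of _ v i] mult.commute[of i v] yv)
  also have "\<dots> = y ^ d"
    by (simp add: ij power_add power_mult[of _ v j] mult.commute[of j v] yv)
  finally have yu: "(y ^ d) ^ (u * k) = y ^ d" .
  have "(w * y ^ k) ^ (d * u) = w ^ (d * u) * (y ^ d) ^ (u * k)"
    by (simp add: power_mult_distrib mult_ac flip: power_mult)
  also have "\<dots> = z"
    using \<open>w \<noteq> 0\<close> by (simp only: yu) (simp add: y)
  finally have 1: "(w * y ^ k) ^ (d * u) = z" .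
  have "(w * y ^ k) ^ (d * v) = c * ((y ^ d) ^ v) ^ k"
    by (simp add: power_mult_distrib mult_ac flip: power_mult w)
  then have 2: "(w * y ^ k) ^ (d * v) = c"
    by (simp add: yv)
  show "z \<in> (\<lambda>y. y ^ (d * u)) ` {y. y ^ (d * v) = c}"
    using 1 2 by (intro image_eqI[where x = "w * y ^ k"]) auto
qed

section \<open>The map z + b / z\<close>

lemma add_divide_eq_add_divide_iff:
  fixes b z w :: "'a :: field"
  assumes "z \<noteq> 0" "w \<noteq> 0"
  shows "z + b / z = w + b / w \<longleftrightarrow> z = w \<or> z = b / w"
proof -
  have "z + b / z = w + b / w \<longleftrightarrow> (z - w) * (z * w - b) = 0"
    using assms by (simp add: field_simps) algebra
  also have "\<dots> \<longleftrightarrow> z = w \<or> z = b / w"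
    using assms by (simp add: eq_divide_eq)
  finally show ?thesis .
qed

text \<open>The fibres of \<open>z + b / z\<close> are the orbits of the involution
  \<open>z \<mapsto> b / z\<close>. Counting each fixed point twice gives every orbit weight
  2.\<close>

lemma card_image_add_divide:
  fixes b :: "'a :: field"
  assumes "finite S" "b \<noteq> 0" "0 \<notin> S" and inv: "\<And>z. z \<in> S \<Longrightarrow> b / z \<in> S"
  shows "2 * card ((\<lambda>z. z + b / z) ` S) = card S + card {z \<in> S. z ^ 2 = b}"
proof -
  let ?f = "\<lambda>z. z + b / z" and ?h = "\<lambda>z. 1 + of_bool (z ^ 2 = b) :: nat"
  have "sum ?h {z \<in> S. ?f z = w} = 2" if "w \<in> ?f ` S" for w
  proof -
    obtain z where z: "z \<in> S" "w = ?f z"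
      using \<open>w \<in> ?f ` S\<close> by auto
    have nz: "z \<noteq> 0"
      using z assms by auto
    have "{x \<in> S. ?f x = w} = {z, b / z}"
    proof -
      have "?f x = w \<longleftrightarrow> x = z \<or> x = b / z" if "x \<in> S" for x
        using that nz \<open>0 \<notin> S\<close> unfolding z(2) by (intro add_divide_eq_add_divide_iff) auto
      then show ?thesis
        using z(1) inv[of z] by blast
    qed
    moreover have "(b / z) ^ 2 = b \<longleftrightarrow> z ^ 2 = b"
      using nz \<open>b \<noteq> 0\<close> by (auto simp: power_divide field_simps power2_eq_square)
    moreover have "z = b / z \<longleftrightarrow> z ^ 2 = b"
      using nz by (simp add: field_simps power2_eq_square)
    ultimately show ?thesis
      by (cases "z = b / z") auto
  qed
  then have "(\<Sum>w\<in>?f ` S. sum ?h {z \<in> S. ?f z = w}) = 2 * card (?f ` S)"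
    by simp
  moreover have "sum ?h S = card S + card {z \<in> S. z ^ 2 = b}"
    using \<open>finite S\<close> by (simp only: sum.distrib of_bool_def sum.If_cases) (simp add: Int_def)
  ultimately show ?thesis
    using sum.image_gen[OF \<open>finite S\<close>, of ?h ?f] by simp
qed

section \<open>Values of integral polynomials\<close>

lemma poly_of_int_pCons:
  "poly (map_poly of_int (pCons c p)) (x :: 'a :: comm_ring_1) =
    of_int c + x * poly (map_poly of_int p) x"
  by (simp add: map_poly_pCons)

lemma poly_of_int_diff:
  "poly (map_poly of_int (p - q)) (x :: 'a :: comm_ring_1) =
    poly (map_poly of_int p) x - poly (map_poly of_int q) x"
proof (induction p q rule: poly_induct2)
  case (pCons c p d q)
  then show ?case
    by (simp add: poly_of_int_pCons right_diff_distrib)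
qed simp

lemma poly_of_int_smult:
  "poly (map_poly of_int (smult c p)) (x :: 'a :: comm_ring_1) =
    of_int c * poly (map_poly of_int p) x"
  by (induction p) (simp_all add: poly_of_int_pCons algebra_simps)

lemma to_ac_poly_of_int:
  "to_ac (poly (map_poly of_int p) x) = poly (map_poly of_int p) (to_ac x)"
  by (induction p) (simp_all add: poly_of_int_pCons)

text \<open>With \<open>x = y + a / y\<close>, both \<open>y\<close> and \<open>a / y\<close> are
  roots of \<open>t ^ 2 - x * t + a\<close>, so the sum of their \<open>n\<close>-th powers obeys
  the Dickson recurrence.\<close>

lemma poly_dickson_poly:
  fixes y :: "'a :: field"
  assumes "y \<noteq> 0"
  shows "poly (map_poly of_int (dickson_poly n a)) (y + of_int a / y) =
    y ^ n + of_int a ^ n / y ^ n"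
proof (induction n a rule: dickson_poly.induct)
  case (3 n a)
  have "(y + of_int a / y) * (y ^ Suc n + of_int a ^ Suc n / y ^ Suc n)
      - of_int a * (y ^ n + of_int a ^ n / y ^ n) =
    y ^ Suc (Suc n) + of_int a ^ Suc (Suc n) / y ^ Suc (Suc n)"
    using assms by (simp add: field_simps)
  then show ?case
    using 3 by (simp add: poly_of_int_diff poly_of_int_smult poly_of_int_pCons)
qed (simp_all add: poly_of_int_pCons)

section \<open>A finite field inside its algebraic closure\<close>

text \<open>With \<open>q = CARD('k)\<close>, the polynomial \<open>x ^ q - x\<close> has at most
  \<open>q\<close> roots, and the embedded field already supplies \<open>q\<close> of them.\<close>

lemma range_to_ac_eq:
  "range (to_ac :: 'k :: {field, finite} \<Rightarrow> _) = {x. x ^ CARD('k) = x}"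
proof (rule card_subset_eq)
  let ?p = "monom 1 CARD('k) - [:0, 1:] :: 'k alg_closure poly"
  have "card {0 :: 'k, 1} \<le> CARD('k)"
    by (rule card_mono) auto
  then have q: "CARD('k) \<ge> 2"
    by simp
  have deg: "degree ?p = CARD('k)"
    using q degree_add_eq_left[of "- [:0, 1:]" "monom (1 :: 'k alg_closure) CARD('k)"]
    by (simp add: degree_monom_eq del: minus_pCons)
  have nz: "?p \<noteq> 0"
    using deg q by auto
  have roots: "{x. x ^ CARD('k) = x} = {x. poly ?p x = 0}"
    by (auto simp: poly_monom)
  show fin: "finite {x :: 'k alg_closure. x ^ CARD('k) = x}"
    unfolding roots using nz by (rule poly_roots_finite)
  have "x ^ CARD('k) = x" for x :: 'k
    using finite_field_power_card_minus_1[of x] q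
    by (cases "x = 0") (auto simp: power_eq_if)
  then show sub: "range (to_ac :: 'k \<Rightarrow> _) \<subseteq> {x. x ^ CARD('k) = x}"
    by (auto simp flip: to_ac_power)
  have "card {x. poly ?p x = 0} \<le> CARD('k)"
    using card_poly_roots_bound[OF nz] deg by simp
  then show "card (range (to_ac :: 'k \<Rightarrow> _)) = card {x :: 'k alg_closure. x ^ CARD('k) = x}"
    using card_mono[OF fin sub] by (simp add: roots card_image inj_to_ac)
qed

text \<open>The characteristic is a prime dividing the prime power \<open>CARD('k)\<close>, hence
  its base. This makes the \<open>CARD('k)\<close>-th power map an iterate of Frobenius.\<close>

lemma CARD_power_CHAR:
  assumes "primepow CARD('k :: {field, finite})"
  shows "\<exists>k. CARD('k) = CHAR('k) ^ k" and "Factorial_Ring.prime CHAR('k)"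
proof -
  have "CHAR('k) > 0"
    by (rule finite_imp_CHAR_pos) simp
  then show "Factorial_Ring.prime CHAR('k)"
    by (rule prime_CHAR_semidom)
  obtain p k where "Factorial_Ring.prime p" "CARD('k) = p ^ k"
    using assms by (auto simp: primepow_def)
  moreover have "CHAR('k) dvd CARD('k)"
    by (rule CHAR_dvd_CARD)
  ultimately show "\<exists>k. CARD('k) = CHAR('k) ^ k"
    using \<open>Factorial_Ring.prime CHAR('k)\<close> by (metis prime_dvd_power primes_dvd_imp_eq)
qed

lemma power_CARD_add:
  fixes x y :: "'k :: {field, finite} alg_closure"
  assumes "primepow CARD('k)"
  shows "(x + y) ^ CARD('k) = x ^ CARD('k) + y ^ CARD('k)"
  using CARD_power_CHAR[OF assms] by (auto intro: freshmans_dream')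

text \<open>Any \<open>x\<close> is \<open>y + c / y\<close> for a root \<open>y\<close> of
  \<open>t ^ 2 - x * t + c\<close>. It lies in the small field iff the \<open>q\<close>-th power map
  fixes it, that is, iff \<open>y ^ q\<close> is one of the two roots \<open>y\<close> and
  \<open>c / y\<close>.\<close>

lemma range_to_ac_parametrization:
  fixes c :: "'k :: {field, finite} alg_closure"
  assumes "primepow CARD('k)" "c \<in> range to_ac" "c \<noteq> 0"
  shows "range to_ac =
    (\<lambda>y. y + c / y) ` ({y. y ^ (CARD('k) - 1) = 1} \<union> {y. y ^ (CARD('k) + 1) = c})"
proof -
  define q where "q = CARD('k)"
  have "q > 1"
    using primepow_gt_Suc_0[OF assms(1)] by (simp add: q_def)
  have c: "c ^ q = c"
    using assms(2) unfolding range_to_ac_eq q_def by simp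
  have fixed: "y + c / y \<in> range to_ac \<longleftrightarrow> y ^ (q - 1) = 1 \<or> y ^ (q + 1) = c"
    if "y \<noteq> 0" for y
  proof -
    have "y ^ q = y \<longleftrightarrow> y ^ (q - 1) = 1"
      using \<open>q > 1\<close> that by (simp add: power_eq_if)
    moreover have "y ^ q = c / y \<longleftrightarrow> y ^ (q + 1) = c"
      using that by (simp add: eq_divide_eq mult.commute)
    moreover have "y + c / y \<in> range to_ac \<longleftrightarrow> y ^ q + c / y ^ q = y + c / y"
      using power_CARD_add[OF assms(1), of y "c / y"]
      unfolding range_to_ac_eq by (simp add: power_divide c flip: q_def)
    ultimately show ?thesis
      using that by (simp add: add_divide_eq_add_divide_iff)
  qed
  have nz: "y \<noteq> 0" if "y ^ (q - 1) = 1 \<or> y ^ (q + 1) = c" for y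
    using that \<open>c \<noteq> 0\<close> \<open>q > 1\<close> by (auto simp: power_0_left)
  have "\<exists>y. y \<noteq> 0 \<and> x = y + c / y" for x
  proof -
    have "degree [:c, -x, 1:] > 0"
      by simp
    then obtain y where y: "poly [:c, -x, 1:] y = 0"
      using alg_closed_imp_poly_has_root by blast
    then have "y \<noteq> 0"
      using \<open>c \<noteq> 0\<close> by auto
    with y show ?thesis
      by (intro exI[of _ y]) (simp add: field_simps; algebra)
  qed
  then have "x \<in> range to_ac \<longleftrightarrow> (\<exists>y. y \<noteq> 0 \<and> x = y + c / y \<and> y + c / y \<in> range to_ac)" for x
    by metis
  then have "x \<in> range to_ac \<longleftrightarrow> (\<exists>y. (y ^ (q - 1) = 1 \<or> y ^ (q + 1) = c) \<and> x = y + c / y)" for x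
    using fixed nz by metis
  then show ?thesis
    unfolding q_def[symmetric] by blast
qed

section \<open>Parities of the cofactors of greatest common divisors\<close>

text \<open>The cofactor of \<open>m\<close> is odd exactly when the gcd absorbs the full power of 2
  in \<open>m\<close>; then the cofactor of \<open>n\<close> is even exactly when \<open>n\<close>
  has a further factor 2.\<close>

lemma odd_div_gcd_iff:
  fixes m n :: nat
  assumes "m > 0"
  shows "odd (m div gcd m n) \<longleftrightarrow> 2 ^ multiplicity 2 m dvd n"
    and "odd (m div gcd m n) \<Longrightarrow>
      even (n div gcd m n) \<longleftrightarrow> 2 ^ (multiplicity 2 m + 1) dvd n"
proof -
  define e d u v where "e = multiplicity 2 m" "d = gcd m n" "u = n div d" "v = m div d"
  note defs = e_d_u_v_def
  have m: "m = d * v" and n: "n = d * u"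
    by (simp_all add: defs)
  have em: "2 ^ e dvd m" and em': "\<not> 2 ^ (e + 1) dvd m"
    using assms
    by (simp_all add: defs(1) multiplicity_dvd power_dvd_iff_le_multiplicity del: power_Suc)
  have d: "2 ^ e dvd d" if "odd v"
    using em that unfolding m by (simp add: coprime_dvd_mult_left_iff)
  show "odd (m div gcd m n) \<longleftrightarrow> 2 ^ multiplicity 2 m dvd n"
    unfolding defs(2)[symmetric] defs(4)[symmetric] defs(1)[symmetric]
  proof
    assume "odd v"
    then show "2 ^ e dvd n"
      using d n by simp
  next
    assume "2 ^ e dvd n"
    then have "2 ^ e dvd d"
      using em by (simp add: defs)
    then show "odd v"
      using em' unfolding m by (metis mult_dvd_mono power_add power_one_right)
  qed
  assume "odd (m div gcd m n)"
  then have v: "odd v"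
    by (simp add: defs)
  have "even u \<longleftrightarrow> 2 ^ (e + 1) dvd n"
  proof
    assume "even u"
    then show "2 ^ (e + 1) dvd n"
      using d[OF v] unfolding n by (metis mult_dvd_mono power_add power_one_right)
  next
    assume *: "2 ^ (e + 1) dvd n"
    show "even u"
    proof (rule ccontr)
      assume "odd u"
      then have "2 ^ (e + 1) dvd d"
        using * unfolding n by (subst (asm) coprime_dvd_mult_left_iff) auto
      then show False
        using em' unfolding m by (meson dvd_mult2)
    qed
  qed
  then show "even (n div gcd m n) \<longleftrightarrow> 2 ^ (multiplicity 2 m + 1) dvd n"
    by (simp add: defs)
qed

lemma multiplicity_2_eq_1:
  fixes m :: nat
  assumes "even m" "\<not> 4 dvd m"
  shows "multiplicity 2 m = 1"
  using assms by (intro multiplicity_eqI) auto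

text \<open>Exactly one of the consecutive even numbers \<open>q - 1\<close> and
  \<open>q + 1\<close> is divisible by 4, so their 2-adic valuations are 1 and \<open>r - 1\<close>
  in some order. As \<open>n\<close> is even, the number of valuation 1 always has an odd
  cofactor.\<close>

lemma gcd_cofactor_parities:
  fixes q n :: nat
  assumes "odd q" "q > 1" "even n"
  defines "d \<equiv> gcd (q - 1) n" and "e \<equiv> gcd (q + 1) n"
    and "r \<equiv> multiplicity 2 (q ^ 2 - 1)"
  shows "odd ((q - 1) div d) \<or> odd ((q + 1) div e)"
    and "power_exactly_dvd 2 (r - 1) n \<longleftrightarrow>
      odd ((q - 1) div d) \<and> odd ((q + 1) div e) \<and> odd (n div d + n div e)"
proof -
  define i j where "i = multiplicity 2 (q - 1)" "j = multiplicity 2 (q + 1)"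
  note ij = i_j_def
  have "q ^ 2 - 1 = (q - 1) * (q + 1)"
    by (simp add: power2_eq_square algebra_simps diff_mult_distrib)
  then have r: "r = i + j"
    unfolding r_def ij using assms(2)
    by (simp only:) (rule prime_elem_multiplicity_mult_distrib, auto)
  have one: "i = 1 \<and> j > 1 \<or> j = 1 \<and> i > 1"
  proof (cases "4 dvd q - 1")
    case True
    then have "i \<ge> 2"
      using assms(2) power_dvd_iff_le_multiplicity[of "q - 1" 2 2] by (simp add: ij)
    moreover have "j = 1"
      unfolding ij using True assms by (intro multiplicity_2_eq_1) presburger+
    ultimately show ?thesis by simp
  next
    case False
    then have "4 dvd q + 1"
      using assms by presburger
    then have "j \<ge> 2"
      using power_dvd_iff_le_multiplicity[of "q + 1" 2 2] by (simp add: ij)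
    moreover have "i = 1"
      unfolding ij using False assms by (intro multiplicity_2_eq_1) auto
    ultimately show ?thesis by simp
  qed
  have mono: "2 ^ l dvd n" if "2 ^ k dvd n" "l \<le> k" for k l :: nat
    using that by (meson dvd_trans le_imp_power_dvd)
  have parity:
    "odd ((q - 1) div d) \<longleftrightarrow> 2 ^ i dvd n" "odd ((q + 1) div e) \<longleftrightarrow> 2 ^ j dvd n"
    "2 ^ i dvd n \<Longrightarrow> even (n div d) \<longleftrightarrow> 2 ^ (i + 1) dvd n"
    "2 ^ j dvd n \<Longrightarrow> even (n div e) \<longleftrightarrow> 2 ^ (j + 1) dvd n"
    using odd_div_gcd_iff[of "q - 1" n] odd_div_gcd_iff[of "q + 1" n] assms(2)
    by (simp_all add: d_def e_def ij)
  show "odd ((q - 1) div d) \<or> odd ((q + 1) div e)"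
    unfolding parity using one \<open>even n\<close> by auto
  from one show "power_exactly_dvd 2 (r - 1) n \<longleftrightarrow>
      odd ((q - 1) div d) \<and> odd ((q + 1) div e) \<and> odd (n div d + n div e)"
  proof (elim disjE conjE)
    assume "i = 1" "j > 1"
    then have "r - 1 = j" "2 ^ i dvd n" "2 ^ j dvd n \<Longrightarrow> 2 ^ (i + 1) dvd n"
      using \<open>even n\<close> mono[of j "i + 1"] by (simp_all add: r)
    then show ?thesis
      unfolding power_exactly_dvd_def parity(1,2) even_add using parity(3,4) by metis
  next
    assume "j = 1" "i > 1"
    then have "r - 1 = i" "2 ^ j dvd n" "2 ^ i dvd n \<Longrightarrow> 2 ^ (j + 1) dvd n"
      using \<open>even n\<close> mono[of i "j + 1"] by (simp_all add: r)
    then show ?thesis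
      unfolding power_exactly_dvd_def parity(1,2) even_add using parity(3,4) by metis
  qed
qed

section \<open>The value set of a Dickson polynomial\<close>

lemma card_Int_pm:
  fixes s :: "'a :: ring_1"
  assumes "s \<noteq> - s"
  shows "card (S \<inter> {s, - s}) = of_bool (s \<in> S) + of_bool (- s \<in> S)"
  using assms by (auto simp: Int_insert_right)

text \<open>Composes the parametrization of the field with the functional equation of
  \<open>dickson_poly\<close>; \<open>power_image_roots\<close> then describes the
  \<open>n\<close>-th powers of both kinds of \<open>y\<close>.\<close>

lemma to_ac_value_set_dickson_poly:
  fixes n :: nat and a :: int
  defines "q \<equiv> CARD('k :: {field, finite})"
  defines "c \<equiv> of_int a :: 'k alg_closure" and "d \<equiv> gcd (q - 1) n" and "e \<equiv> gcd (q + 1) n"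
  assumes "primepow q" "c \<noteq> 0"
  shows "to_ac ` (value_set (dickson_poly n a) :: 'k set) =
    (\<lambda>z. z + c ^ n / z) ` ({z. z ^ ((q - 1) div d) = 1} \<union> {z. z ^ ((q + 1) div e) = c ^ (n div e)})"
proof -
  let ?D = "poly (map_poly of_int (dickson_poly n a))"
  define A B where "A = {y. y ^ (q - 1) = (1 :: 'k alg_closure)}" "B = {y. y ^ (q + 1) = c}"
  have "q > 1"
    using primepow_gt_Suc_0[OF \<open>primepow q\<close>] by simp
  have pos: "d > 0" "(q - 1) div d > 0" "e > 0" "(q + 1) div e > 0"
    using \<open>q > 1\<close> by (auto simp: d_def e_def div_greater_zero_iff intro!: gcd_le1_nat)
  have cop: "coprime (n div d) ((q - 1) div d)" "coprime (n div e) ((q + 1) div e)"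
    using \<open>q > 1\<close> unfolding d_def e_def
    by (metis add_is_0 coprime_commute div_gcd_coprime less_numeral_extra(3) one_neq_zero
        zero_less_diff)+
  have dvd: "d dvd q - 1" "d dvd n" "e dvd q + 1" "e dvd n"
    by (simp_all add: d_def e_def)
  have A: "(\<lambda>y. y ^ n) ` A = {z. z ^ ((q - 1) div d) = 1}"
    using power_image_roots[OF pos(1,2) cop(1), of "1 :: 'k alg_closure"] dvd
    by (simp add: A_B_def del: One_nat_def)
  have B: "(\<lambda>y. y ^ n) ` B = {z. z ^ ((q + 1) div e) = c ^ (n div e)}"
    using power_image_roots[OF pos(3,4) cop(2) \<open>c \<noteq> 0\<close>] dvd
    unfolding A_B_def by (simp only: dvd_mult_div_cancel)
  have "to_ac ` (value_set (dickson_poly n a) :: 'k set) = ?D ` range to_ac"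
    by (simp add: value_set_def image_image to_ac_poly_of_int)
  also have "range to_ac = (\<lambda>y. y + c / y) ` (A \<union> B)"
    unfolding A_B_def q_def
  proof (rule range_to_ac_parametrization)
    show "c \<in> range to_ac"
      unfolding c_def by (metis rangeI to_ac_of_int)
  qed (use assms in auto)
  also have "?D ` \<dots> = (\<lambda>y. y ^ n + c ^ n / y ^ n) ` (A \<union> B)"
    unfolding image_image
  proof (rule image_cong[OF refl])
    fix y assume "y \<in> A \<union> B"
    then have "y \<noteq> 0"
      using \<open>c \<noteq> 0\<close> \<open>q > 1\<close> by (auto simp: A_B_def power_0_left)
    then show "?D (y + c / y) = y ^ n + c ^ n / y ^ n"
      unfolding c_def by (rule poly_dickson_poly)
  qed
  also have "\<dots> = (\<lambda>z. z + c ^ n / z) ` ((\<lambda>y. y ^ n) ` A \<union> (\<lambda>y. y ^ n) ` B)"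
    by (simp add: image_image image_Un)
  finally show ?thesis
    by (simp add: A B)
qed

text \<open>Twice the size is \<open>v + v'\<close> plus the number of fixed points lying in exactly
  one of \<open>A\<close> and \<open>B\<close>. The correction term is kept here as a parity
  condition.\<close>

lemma card_value_set_dickson_poly:
  fixes n :: nat and a :: int
  defines "q \<equiv> CARD('k :: {field, finite})"
  defines "d \<equiv> gcd (q - 1) n" and "e \<equiv> gcd (q + 1) n"
  assumes "primepow q" "odd q" "even n" "(of_int a :: 'k) \<noteq> 0"
  shows "card (value_set (dickson_poly n a) :: 'k set) =
    (q - 1) div (2 * d) + (q + 1) div (2 * e) + 1 +
    of_bool (quadratic_char (of_int a :: 'k) = - 1 \<and>
      odd ((q - 1) div d) \<and> odd ((q + 1) div e) \<and> odd (n div d + n div e))"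
proof -
  define c where "c = (of_int a :: 'k alg_closure)"
  define u v u' v' where "u = n div d" "v = (q - 1) div d" "u' = n div e" "v' = (q + 1) div e"
  note uv = u_v_u'_v'_def
  define A B where "A = {z. z ^ v = (1 :: 'k alg_closure)}" "B = {z. z ^ v' = c ^ u'}"
  \<comment> \<open>The fixed points of \<open>z \<mapsto> c ^ n / z\<close> are \<open>s\<close>
    and \<open>- s\<close>; \<open>\<chi>\<close> below is the quadratic character of
    \<open>a\<close> carried to the closure.\<close>
  define s where "s = c ^ (n div 2)"
  define \<chi> where "\<chi> = c ^ ((q - 1) div 2)"
  have "q > 1"
    using primepow_gt_Suc_0[OF \<open>primepow q\<close>] by simp
  have c: "c \<noteq> 0" and c_ac: "c = to_ac (of_int a)"
    using assms by (simp_all add: c_def flip: to_ac_of_int)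
  have n: "n = d * u" "n = e * u'" and q: "q - 1 = d * v" "q + 1 = e * v'"
    by (simp_all add: uv d_def e_def)
  have cop: "coprime u v" "coprime u' v'"
    using \<open>q > 1\<close> unfolding uv d_def e_def
    by (metis add_is_0 coprime_commute div_gcd_coprime less_numeral_extra(3) one_neq_zero
        zero_less_diff)+
  have vpos: "v > 0" "v' > 0"
    using q \<open>q > 1\<close> by (auto intro: Nat.gr0I)
  have "of_nat q = (0 :: 'k)"
    unfolding q_def of_nat_eq_0_iff_char_dvd by (rule CHAR_dvd_CARD)
  then have q0: "of_nat q = (0 :: 'k alg_closure)"
    by (metis to_ac_0 to_ac_of_nat)
  \<comment> \<open>These products are \<open>q - 1\<close> and \<open>q + 1\<close>, so they become
    \<open>- 1\<close> and \<open>1\<close> in the field; hence \<open>v\<close> and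
    \<open>v'\<close> are nonzero there.\<close>
  then have "of_nat (d * v) \<noteq> (0 :: 'k alg_closure)" "of_nat (e * v') \<noteq> (0 :: 'k alg_closure)"
    using \<open>q > 1\<close> by (simp_all add: of_nat_diff flip: q)
  then have card: "card A = v" "card B = v'"
    unfolding A_B_def using c by (auto intro!: card_nth_roots_alg_closed)
  then have fin: "finite A" "finite B"
    using vpos by (auto intro: card_ge_0_finite)
  have two: "(2 :: 'k alg_closure) \<noteq> 0"
  proof
    assume "(2 :: 'k alg_closure) = 0"
    moreover have "of_nat q = (1 + of_nat (q div 2) * 2 :: 'k alg_closure)"
      using \<open>odd q\<close> by (metis of_nat_1 of_nat_add of_nat_mult of_nat_numeral add.commute
          odd_two_times_div_two_succ mult.commute)
    ultimately show False
      using q0 by simp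
  qed
  have "c ^ (q - 1) = 1"
    using finite_field_power_card_minus_1[OF assms(7)]
    unfolding c_ac q_def by (metis to_ac_1 to_ac_power)
  then have "\<chi> ^ 2 = 1"
    using \<open>odd q\<close> by (simp add: \<chi>_def flip: power_mult)
  then have \<chi>: "\<chi> = 1 \<or> \<chi> = - 1"
    by (simp add: power2_eq_1_iff)
  have \<chi>_iff: "quadratic_char (of_int a :: 'k) = - 1 \<longleftrightarrow> \<chi> = - 1"
  proof -
    have "\<chi> = to_ac (quadratic_char (of_int a))"
      by (simp add: \<chi>_def c_ac quadratic_char_def q_def)
    then show ?thesis
      by (metis to_ac_1 to_ac_minus to_ac_eq_iff)
  qed
  have pm: "(1 :: 'k alg_closure) \<noteq> - 1"
    using two by (metis add.right_inverse one_add_one)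
  have s: "s ^ 2 = c ^ n" "s \<noteq> 0"
    using \<open>even n\<close> c by (simp_all add: s_def flip: power_mult)
  have s_ne: "s \<noteq> - s"
    using s(2) two by (metis add.right_inverse mult_2 mult_eq_0_iff)
  have sv: "s ^ v = \<chi> ^ u"
  proof -
    have "n div 2 * v = (q - 1) div 2 * u"
    proof -
      have "2 * (n div 2) = d * u" "2 * ((q - 1) div 2) = d * v"
        using \<open>even n\<close> \<open>odd q\<close> by (simp_all flip: n(1) q(1))
      then have "2 * (n div 2) * v = 2 * ((q - 1) div 2) * u"
        by (simp only: mult_ac)
      then show ?thesis by simp
    qed
    then show ?thesis
      by (simp add: s_def \<chi>_def flip: power_mult)
  qed
  \<comment> \<open>As \<open>(q + 1) div 2\<close> exceeds \<open>(q - 1) div 2\<close> by one, an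
    extra factor \<open>c ^ u'\<close> appears. It is the right-hand side of the equation of
    \<open>B\<close>, so only \<open>\<chi> ^ u'\<close> decides whether \<open>s\<close> lies in
    \<open>B\<close>.\<close>
  have sv': "s ^ v' = c ^ u' * \<chi> ^ u'"
  proof -
    have "n div 2 * v' = (q + 1) div 2 * u'"
    proof -
      have "2 * (n div 2) = e * u'" "2 * ((q + 1) div 2) = e * v'"
        using \<open>even n\<close> \<open>odd q\<close> by (simp_all flip: n(2) q(2))
      then have "2 * (n div 2) * v' = 2 * ((q + 1) div 2) * u'"
        by (simp only: mult_ac)
      then show ?thesis by simp
    qed
    moreover have "(q + 1) div 2 = Suc ((q - 1) div 2)"
      using \<open>odd q\<close> \<open>q > 1\<close> by presburger
    ultimately show ?thesis
      by (simp add: s_def \<chi>_def power_mult_distrib[symmetric] flip: power_mult power_Suc power_add)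
  qed
  have mem: "s \<in> A \<longleftrightarrow> \<chi> ^ u = 1" "- s \<in> A \<longleftrightarrow> \<chi> ^ u * (- 1) ^ v = 1"
    "s \<in> B \<longleftrightarrow> \<chi> ^ u' = 1" "- s \<in> B \<longleftrightarrow> \<chi> ^ u' * (- 1) ^ v' = 1"
    using c sv sv' by (auto simp: A_B_def power_minus[of s] mult_ac)
  have fixed: "{z \<in> S. z ^ 2 = c ^ n} = S \<inter> {s, - s}" for S
    by (auto simp: power2_eq_iff simp flip: s(1))
  \<comment> \<open>\<open>z ^ 2 = z ^ (q + 1) = c ^ n\<close> on the intersection\<close>
  have inter: "A \<inter> B = A \<inter> B \<inter> {s, - s}"
  proof -
    have "z ^ 2 = c ^ n" if "z \<in> A" "z \<in> B" for z
    proof -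
      have "z ^ (q - 1) = 1"
        using that unfolding q A_B_def by (simp add: mult.commute[of d] power_mult)
      moreover have "z ^ (q + 1) = c ^ n"
        using that unfolding q n(2) A_B_def
        by (simp add: mult.commute[of e] power_mult)
      moreover have "z ^ (q + 1) = z ^ (q - 1) * z ^ 2"
        using \<open>q > 1\<close> by (simp flip: power_add)
      ultimately show ?thesis by simp
    qed
    then show ?thesis
      using fixed[of "A \<inter> B"] by auto
  qed
  have "to_ac ` (value_set (dickson_poly n a) :: 'k set) = (\<lambda>z. z + c ^ n / z) ` (A \<union> B)"
    using to_ac_value_set_dickson_poly[of a n, where ?'k = 'k] assms c
    unfolding A_B_def uv d_def e_def q_def c_def by simp
  then have "card (value_set (dickson_poly n a) :: 'k set) = card ((\<lambda>z. z + c ^ n / z) ` (A \<union> B))"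
    by (metis card_image inj_to_ac inj_on_subset subset_UNIV)
  also have "2 * \<dots> = card (A \<union> B) + card {z \<in> A \<union> B. z ^ 2 = c ^ n}"
  proof (rule card_image_add_divide)
    show "0 \<notin> A \<union> B"
      using c vpos by (auto simp: A_B_def power_0_left)
    have "c ^ n / z \<in> A" if "z \<in> A" for z
    proof -
      have "(c ^ n) ^ v = (c ^ (q - 1)) ^ u"
        unfolding n(1) q(1) by (simp add: mult_ac flip: power_mult)
      then show ?thesis
        using that \<open>c ^ (q - 1) = 1\<close> by (simp add: A_B_def power_divide)
    qed
    \<comment> \<open>Here \<open>(c ^ n) ^ v'\<close> is \<open>c ^ (2 * u')\<close>, and dividing
      by \<open>z ^ v' = c ^ u'\<close> leaves \<open>c ^ u'\<close>.\<close>
    moreover have "c ^ n / z \<in> B" if "z \<in> B" for z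
    proof -
      have "c ^ (q + 1) = c ^ 2"
        using \<open>c ^ (q - 1) = 1\<close> \<open>q > 1\<close>
        by (metis (no_types, lifting) add.commute le_add_diff_inverse less_imp_le mult_1 
            nat_1_add_1 add.assoc power_add)
      moreover have "(c ^ n) ^ v' = (c ^ (q + 1)) ^ u'"
        unfolding n(2) q(2) by (simp add: mult_ac flip: power_mult)
      ultimately show ?thesis
        using that c by (simp add: A_B_def power_divide power2_eq_square power_mult_distrib)
    qed
    ultimately show "c ^ n / z \<in> A \<union> B" if "z \<in> A \<union> B" for z
      using that by blast
  qed (use fin c in auto)
  \<comment> \<open>Inclusion-exclusion for \<open>A \<union> B\<close>, with the intersection term
    on the left to avoid subtraction in \<open>nat\<close>.\<close>
  finally have "2 * card (value_set (dickson_poly n a) :: 'k set) + card (A \<inter> B \<inter> {s, - s}) =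
      v + v' + card ((A \<union> B) \<inter> {s, - s})"
    using card_Un_Int[OF fin] arg_cong[OF inter, of card] card unfolding fixed by linarith
  \<comment> \<open>If \<open>\<chi> = 1\<close>, then \<open>s\<close> is in both sets, and
    \<open>- s\<close> is in \<open>A\<close> or \<open>B\<close> according to whether
    \<open>v\<close> or \<open>v'\<close> is even. If \<open>\<chi> = - 1\<close>, an even
    \<open>v\<close> forces \<open>u\<close> odd and keeps both points out of \<open>A\<close>,
    while an odd \<open>v\<close> puts exactly one in \<open>A\<close>, chosen by the parity of
    \<open>u\<close>; likewise for \<open>B\<close>. The extra 2 arises when \<open>A\<close> and
    \<open>B\<close> pick different points.\<close>
  moreover have "card ((A \<union> B) \<inter> {s, - s}) + of_bool (odd v) + of_bool (odd v') =
      card (A \<inter> B \<inter> {s, - s}) + 2 +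
      2 * of_bool (\<chi> = - 1 \<and> odd v \<and> odd v' \<and> odd (u + u'))"
  proof -
    have "odd v \<or> odd v'"
      using gcd_cofactor_parities(1)[OF \<open>odd q\<close> \<open>q > 1\<close> \<open>even n\<close>] by (simp add: uv d_def e_def)
    moreover have "odd u \<or> odd v" "odd u' \<or> odd v'"
      using cop by (auto dest: coprime_common_divisor)
    ultimately show ?thesis
      using \<chi> pm pm[symmetric]
      unfolding card_Int_pm[OF s_ne] Int_iff Un_iff mem
      by (elim disjE; cases "even u"; cases "even u'"; cases "even v"; cases "even v'") simp_all
  qed
  \<comment> \<open>The remainders of \<open>v\<close> and \<open>v'\<close> modulo 2 cancel the two
    parity terms just added, so the equation can be halved.\<close>
  moreover have "v = 2 * (v div 2) + of_bool (odd v)" "v' = 2 * (v' div 2) + of_bool (odd v')"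
    by (simp_all add: odd_two_times_div_two_succ)
  ultimately have "card (value_set (dickson_poly n a) :: 'k set) =
      v div 2 + v' div 2 + 1 + of_bool (\<chi> = - 1 \<and> odd v \<and> odd v' \<and> odd (u + u'))"
    by linarith
  then show ?thesis
    by (simp add: \<chi>_iff uv div_mult2_eq mult.commute[of 2])
qed

theorem theorem1p4:
  fixes q n d \<delta> r :: nat and a :: int
  assumes "q = CARD('k :: {field, finite})"
    and "primepow q" and "odd q"
    and "(of_int a :: 'k) \<noteq> 0"
    and "even n"
    and "d = gcd (q - 1) n"
    and "\<delta> = gcd (q + 1) n"
    and "r = multiplicity 2 (q ^ 2 - 1)"
  shows "int (card (value_set (dickson_poly n a) :: 'k set)) =
    \<lfloor>(real q - 1) / (2 * real d)\<rfloor> + \<lfloor>(real q + 1) / (2 * real \<delta>)\<rfloor> + 1 +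
    (if quadratic_char (of_int a :: 'k) = - 1 \<and> power_exactly_dvd 2 (r - 1) n then 1 else 0)"
proof -
  have q: "q > 1"
    using primepow_gt_Suc_0[OF assms(2)] by simp
  then have "real q - 1 = real (q - 1)"
    by simp
  moreover have "\<lfloor>real (q - 1) / (2 * real d)\<rfloor> = int ((q - 1) div (2 * d))"
    using floor_divide_of_nat_eq[of "q - 1" "2 * d", where ?'a = real] by simp
  moreover have "\<lfloor>(real q + 1) / (2 * real \<delta>)\<rfloor> = int ((q + 1) div (2 * \<delta>))"
    using floor_divide_of_nat_eq[of "q + 1" "2 * \<delta>", where ?'a = real] by (simp add: add.commute)
  \<comment> \<open>The parity condition on the cofactors becomes the condition on
    \<open>2 ^ (r - 1)\<close>.\<close>
  moreover have "card (value_set (dickson_poly n a) :: 'k set) =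
    (q - 1) div (2 * d) + (q + 1) div (2 * \<delta>) + 1 +
    of_bool (quadratic_char (of_int a :: 'k) = - 1 \<and> power_exactly_dvd 2 (r - 1) n)"
    using card_value_set_dickson_poly[of n a, where ?'k = 'k]
      gcd_cofactor_parities(2)[OF \<open>odd q\<close> q \<open>even n\<close>] assms(2-5)
    unfolding assms(1,6-8) by (simp only: simp_thms)
  ultimately show ?thesis
    by (simp only: of_nat_add of_nat_1 of_nat_of_bool) (simp only: of_bool_def)
qed

end
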